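(* Let $\mathcal{A}=\sum_{i=1}^N A^{(i)}\frac{\partial}{\partial x_i}$, with $A^{(i)}\in\mathbb{R}^{m\times d}$, be a first order linear differential operator satisfying $\mathrm{rank}\left(\sum_{i=1}^N A^{(i)}w_i\right)=m$ for every $w\in\mathbb{R}^N\setminus\{0\}$, and let $\Lambda$ be its characteristic cone. Let $E\subset\mathbb{R}^d$. Set $\Lambda_0\mathrm{co}E=E$ and, for $i=0,1,2,\ldots$, $$\Lambda_{i+1}\mathrm{co}E=\{\xi\in\mathbb{R}^d:\ \xi=ta+(1-t)b,\ a,b\in\Lambda_i\mathrm{co}E,\ b-a\in\Lambda,\ t\in[0,1]\}.$$ Then $$\Lambda\mathrm{co}E=\bigcup_{i\ge0}\Lambda_i\mathrm{co}E.$$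
   Context: The characteristic cone of $\mathcal{A}$ is $\Lambda=\{v\in\mathbb{R}^d:\exists w\in\mathbb{R}^N\setminus\{0\},\ (\sum_{i=1}^N A^{(i)}w_i)v=0\}$. A function $G:\mathbb{R}^d\to\mathbb{R}\cup\{+\infty\}$ is $\Lambda$-convex if it is convex along the directions of $\Lambda$, i.e. $G(ta+(1-t)b)\le tG(a)+(1-t)G(b)$ for all $t\in[0,1]$ and all $a,b\in\mathbb{R}^d$ with $b-a\in\Lambda$ (with the convention $0\cdot(+\infty)=0$). For $E\subset\mathbb{R}^d$, $$\Lambda\mathrm{co}E=\{\xi\in\mathbb{R}^d: G(\xi)\le0\text{ for every }\Lambda\text{-convex } G:\mathbb{R}^d\to\mathbb{R}\cup\{+\infty\}\text{ with }G=0\text{ on }E\}.$$ *)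

theory Defs
  imports "HOL-Analysis.Analysis"
begin

text \<open>
  The constant-coefficient operator \<open>\<Sum>i. A i \<partial>/\<partial>x\<^sub>i\<close> on \<open>\<real>\<^sup>N\<close>, acting on \<open>\<real>\<^sup>d\<close>-valued maps with values in
  \<open>\<real>\<^sup>m\<close>, is represented by its family \<open>A\<close> of \<open>m \<times> d\<close> coefficient matrices; the index types
  \<open>'n\<close>, \<open>'d\<close>, \<open>'m\<close> have \<open>N\<close>, \<open>d\<close>, \<open>m\<close> elements.
\<close>

definition op_symbol :: "('n::finite \<Rightarrow> real^'d^'m) \<Rightarrow> real^'n \<Rightarrow> real^'d^'m" where
  "op_symbol A w = (\<Sum>i\<in>UNIV. w $ i *\<^sub>R A i)"

definition characteristic_cone :: "('n::finite \<Rightarrow> real^'d^'m) \<Rightarrow> (real^'d) set" where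
  "characteristic_cone A = {v. \<exists>w. w \<noteq> 0 \<and> op_symbol A w *v v = 0}"

text \<open>
  Values in \<open>\<real> \<union> {+\<infinity>}\<close> are extended reals other than \<open>-\<infinity>\<close>; multiplication on \<^typ>\<open>ereal\<close>
  satisfies \<open>0 * \<infinity> = 0\<close>.
\<close>

definition cone_convex :: "(real^'d) set \<Rightarrow> (real^'d \<Rightarrow> ereal) \<Rightarrow> bool" where
  "cone_convex L G \<longleftrightarrow> (\<forall>x. G x \<noteq> -\<infinity>) \<and>
     (\<forall>t\<in>{0..1}. \<forall>a b. b - a \<in> L \<longrightarrow>
        G (t *\<^sub>R a + (1 - t) *\<^sub>R b) \<le> ereal t * G a + ereal (1 - t) * G b)"

definition cone_hull :: "(real^'d) set \<Rightarrow> (real^'d) set \<Rightarrow> (real^'d) set" where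
  "cone_hull L E = {\<xi>. \<forall>G. cone_convex L G \<and> (\<forall>x\<in>E. G x = 0) \<longrightarrow> G \<xi> \<le> 0}"

primrec cone_layer :: "(real^'d) set \<Rightarrow> (real^'d) set \<Rightarrow> nat \<Rightarrow> (real^'d) set" where
  "cone_layer L E 0 = E"
| "cone_layer L E (Suc i) =
     {t *\<^sub>R a + (1 - t) *\<^sub>R b | t a b.
        a \<in> cone_layer L E i \<and> b \<in> cone_layer L E i \<and> b - a \<in> L \<and> t \<in> {0..1}}"

end

theory Submission
  imports Defs
begin

text \<open>
  A \<open>\<Lambda>\<close>-convex function vanishing on \<open>E\<close> is nonpositive on each layer. Conversely, the union of the
  layers is closed under segments in \<open>\<Lambda>\<close>-directions, so the function that is \<open>0\<close> on it and
  \<open>+\<infinity>\<close> elsewhere is \<open>\<Lambda>\<close>-convex, and it excludes every point outside the union.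
\<close>

text \<open>Every matrix kills \<open>0\<close>, so any nonzero \<open>w\<close> is a witness; the
  all-ones vector \<open>1\<close> is chosen.\<close>

lemma zero_in_characteristic_cone: "0 \<in> characteristic_cone (A :: 'n::finite \<Rightarrow> real^'d^'m)"
proof -
  have "(1 :: real^'n) \<noteq> 0" by simp
  then show ?thesis
    unfolding characteristic_cone_def by (auto intro!: exI[of _ "1 :: real^'n"])
qed

text \<open>With \<open>0\<close> an admissible direction, each point is a degenerate segment from
  itself to itself and so survives into the next layer.\<close>

lemma mono_cone_layer:
  assumes "0 \<in> L"
  shows "mono (cone_layer L E)"
proof (rule mono_iff_le_Suc[THEN iffD2], intro allI subsetI)
  fix i x assume "x \<in> cone_layer L E i"
  with assms show "x \<in> cone_layer L E (Suc i)"
    by (auto intro!: exI[of _ 1] exI[of _ x])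
qed

text \<open>The sublevel set where \<open>G\<close> is at most \<open>0\<close> is closed under
  segments in directions of \<open>L\<close>, so it absorbs one layer after another.\<close>

lemma cone_convex_nonpos_on_cone_layer:
  assumes G: "cone_convex L G" and E: "\<forall>x\<in>E. G x \<le> 0"
  shows "x \<in> cone_layer L E i \<Longrightarrow> G x \<le> 0"
proof (induction i arbitrary: x)
  case 0
  with E show ?case by simp
next
  case (Suc i)
  then obtain t a b where x: "x = t *\<^sub>R a + (1 - t) *\<^sub>R b" and t: "t \<in> {0..1}"
    and "b - a \<in> L" and ab: "G a \<le> 0" "G b \<le> 0"
    by auto
  with G have "G x \<le> ereal t * G a + ereal (1 - t) * G b"
    unfolding cone_convex_def by blast
  also have "\<dots> \<le> 0 + 0"
    using ab t by (intro add_mono) (auto simp: ereal_mult_le_0_iff)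
  finally show ?case by simp
qed

lemma cone_convex_indicator:
  assumes U: "\<And>t a b. \<lbrakk>a \<in> U; b \<in> U; b - a \<in> L; t \<in> {0..1}\<rbrakk> \<Longrightarrow> t *\<^sub>R a + (1 - t) *\<^sub>R b \<in> U"
  shows "cone_convex L (\<lambda>x. if x \<in> U then 0 else \<infinity>)"
  unfolding cone_convex_def
proof (intro conjI allI ballI impI)
  fix t :: real and a b :: "real^'a"
  assume t: "t \<in> {0..1}" and L: "b - a \<in> L"
  let ?G = "\<lambda>x. if x \<in> U then 0 else \<infinity> :: ereal"
  \<comment> \<open>At the endpoints \<open>0 * \<infinity> = 0\<close> leaves only the value at
    \<open>b\<close> or \<open>a\<close>. For interior \<open>t\<close> the right side is
    \<open>\<infinity>\<close> unless \<open>a\<close> and \<open>b\<close> both lie in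
    \<open>U\<close>, where closure applies.\<close>
  consider "t = 0" | "t = 1" | "0 < t" "t < 1"
    using t by fastforce
  then show "?G (t *\<^sub>R a + (1 - t) *\<^sub>R b) \<le> ereal t * ?G a + ereal (1 - t) * ?G b"
    by cases (use U[OF _ _ L t] in \<open>auto simp: zero_ereal_def[symmetric] one_ereal_def[symmetric]\<close>)
qed simp

lemma cone_hull_eq_UN_cone_layer:
  assumes "0 \<in> L"
  shows "cone_hull L E = (\<Union>i. cone_layer L E i)"
proof
  let ?U = "\<Union>i. cone_layer L E i"
  show "?U \<subseteq> cone_hull L E"
    unfolding cone_hull_def using cone_convex_nonpos_on_cone_layer by fastforce
  have "t *\<^sub>R a + (1 - t) *\<^sub>R b \<in> ?U"
    if ab: "a \<in> ?U" "b \<in> ?U" and L: "b - a \<in> L" and t: "t \<in> {0..1}" for t a b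
  proof -
    from ab obtain i j where "a \<in> cone_layer L E i" "b \<in> cone_layer L E j"
      by blast
    \<comment> \<open>The endpoints may come from different layers; monotonicity moves both into a
      common one.\<close>
    then have "a \<in> cone_layer L E (max i j)" "b \<in> cone_layer L E (max i j)"
      using monoD[OF mono_cone_layer[OF assms]] by (meson max.cobounded1 max.cobounded2 subsetD)+
    with L t have "t *\<^sub>R a + (1 - t) *\<^sub>R b \<in> cone_layer L E (Suc (max i j))"
      by auto
    then show ?thesis by blast
  qed
  then have G: "cone_convex L (\<lambda>x. if x \<in> ?U then 0 else \<infinity>)"
    by (rule cone_convex_indicator)
  have E: "E \<subseteq> ?U"
    using UN_upper[of 0 UNIV "cone_layer L E"] by simp
  show "cone_hull L E \<subseteq> ?U"
  proof
    fix x assume "x \<in> cone_hull L E"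
    then have hull: "G x \<le> 0" if "cone_convex L G" "\<forall>y\<in>E. G y = 0" for G
      using that unfolding cone_hull_def by simp
    have "\<forall>y\<in>E. (if y \<in> ?U then 0 else \<infinity> :: ereal) = 0"
      using E by (metis subsetD)
    \<comment> \<open>Were \<open>x\<close> outside the union, the bound would read
      \<open>\<infinity> \<le> 0\<close>.\<close>
    from hull[OF G this] show "x \<in> ?U"
      by (rule contrapos_pp) (simp only: if_False, simp)
  qed
qed

theorem proposition3p14:
  fixes A :: "'n::finite \<Rightarrow> real^'d^'m" and E :: "(real^'d) set"
  assumes "\<And>w :: real^'n. w \<noteq> 0 \<Longrightarrow> rank (op_symbol A w) = CARD('m)"
  shows "cone_hull (characteristic_cone A) E = (\<Union>i. cone_layer (characteristic_cone A) E i)"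
  by (rule cone_hull_eq_UN_cone_layer[OF zero_in_characteristic_cone])

end
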